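(* Let $k\ge 1$ and assume $\operatorname{int}S_{k-1}\neq\emptyset$. Suppose $\mathbf{x}_{k-1}\in\partial S_{k-1}$ and $\mathbf{x}_{k-1}^{\ast}\in C_{S_{k-1}}^{O}(\mathbf{x}_{k-1})$. If $(v_k,y_k,v_k^{\ast},y_k^{\ast})\in M\left(C\mathbf{x}_{k-1},(\mathbf{x}_{k-1}^{\ast})_1,z_k\right)$ and $\mathbf{x}_k^{\ast}:=A^{\ast}\mathbf{x}_{k-1}^{\ast}+B^{\ast}y_k^{\ast}\neq\mathbf{0}$, then $\mathbf{x}_k:=A\mathbf{x}_{k-1}+Bv_k\in\partial S_k$, $\mathbf{x}_k$ is a successor to $\mathbf{x}_{k-1}$, and $\mathbf{x}_k^{\ast}\in C_{S_k}^{O}(\mathbf{x}_k)$.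
   Context: Let $m\ge 1$ be an integer, and let $(d_1,\dots,d_{m+1})$, $(n_1,\dots,n_{m+1})$ be real vectors with $d_1=1$, $d_{m+1}\neq 0$, such that the polynomials $\sum_{i=1}^{m+1}n_i\lambda^{i-1}$ and $\sum_{i=1}^{m+1}d_i\lambda^{i-1}$ are coprime. Estimation system. $A$ is the $m\times m$ matrix with ones on the first superdiagonal, last row $(-d_{m+1},-d_m,\dots,-d_2)$ and zeros elsewhere; $B=(0,\dots,0,1)^T\in\mathbb{R}^m$; $C$ is the row vector $(n_{m+1},\dots,n_2)-n_1(d_{m+1},\dots,d_2)$; $D_1=n_1$. The dynamics are $\mathbf{x}_k=A\mathbf{x}_{k-1}+Bv_k$, $y_k=C\mathbf{x}_{k-1}+D_1v_k$, with given initial state $\mathbf{x}_0\in\mathbb{R}^m$ and given real measurements $z_1,z_2,\dots$. The uncertainty sets are the polytopes $S_0=\{\mathbf{x}_0\}$ and, for $k\ge1$, $$S_k=\{A\mathbf{x}+Bv:\ \mathbf{x}\in S_{k-1},\ |v|\le 1,\ |C\mathbf{x}+D_1v-z_k|\le 1\}.$$ $\mathbf{x}_k\in S_k$ is a successor to $\mathbf{x}_{k-1}\in S_{k-1}$ if there is a scalar $v$ with $|v|\le1$, $|C\mathbf{x}_{k-1}+D_1v-z_k|\le1$ and $\mathbf{x}_k=A\mathbf{x}_{k-1}+Bv$. Regulator matrices. $A^{\ast}$ is the $m\times m$ matrix with first column $-\frac{1}{d_{m+1}}(d_m,d_{m-1},\dots,d_1)^T$, ones on the first superdiagonal, zeros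 elsewhere (for $m=1$, $A^{\ast}=-1/d_2$); $B^{\ast}=(n_m,\dots,n_1)^T-\frac{n_{m+1}}{d_{m+1}}(d_m,\dots,d_1)^T$. For a polytope $S\subset\mathbb{R}^m$, $\partial S$ and $\operatorname{int}S$ are its boundary and interior, $h_S(\mathbf{x}^{\ast})=\max_{\mathbf{x}\in S}\langle\mathbf{x}^{\ast},\mathbf{x}\rangle$, and for $\mathbf{x}\in\partial S$, $C_S^{O}(\mathbf{x})=\{\mathbf{x}^{\ast}\neq\mathbf{0}:\langle\mathbf{x}^{\ast},\mathbf{x}\rangle=h_S(\mathbf{x}^{\ast})\}$. $(\mathbf{x}^{\ast})_1$ is the first component of $\mathbf{x}^{\ast}$. The scalar pair $(y,v)$ is aligned at time $k$ with $(y^{\ast},v^{\ast})$ if: $v^{\ast}>0\Rightarrow v=1$; $v^{\ast}<0\Rightarrow v=-1$; $|v|<1\Rightarrow v^{\ast}=0$; $y^{\ast}>0\Rightarrow y=1+z_k$; $y^{\ast}<0\Rightarrow y=-1+z_k$; $|y-z_k|<1\Rightarrow y^{\ast}=0$. For scalars $s,t,z_k$, $M(s,t,z_k)$ is the set of quadruples $\mathbf{q}=(v,y,v^{\ast},y^{\ast})\in\mathbb{R}^4$ with: $|v|\le1$ and $|y-z_k|\le1$; $y-n_1v=s$; $d_{m+1}v^{\ast}+n_{m+1}y^{\ast}=-t$; and $(y,v)$ aligned at time $k$ with $(y^{\ast},v^{\ast})$. *)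

theory Defs
  imports "HOL-Analysis.Analysis" "HOL-Computational_Algebra.Polynomial"
begin

text \<open>
  Vectors in $R^m$ are elements of \<open>real ^ 'm\<close> where \<open>'m\<close> is a finite linearly ordered type and
  $m$ is \<open>CARD('m)\<close>.  The linear order gives meaning to ``first'', ``last'' and ``superdiagonal'':
  \<open>pos i\<close> is the 1-based rank of the index \<open>i\<close>.  The coefficient vectors
  $(d_1,\ldots,d_{m+1})$ and $(n_1,\ldots,n_{m+1})$ are functions on \<open>nat\<close>, of which only the values
  at $1,\ldots,m+1$ are ever used; similarly $z_k$ is used for $k \geq 1$ only.
\<close>

definition pos :: "'m::{finite,linorder} \<Rightarrow> nat" where
  "pos i = card {j. j \<le> i}"

lemma bij_betw_pos: "bij_betw pos (UNIV :: 'm::{finite,linorder} set) {1..CARD('m)}"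
proof -
  have mono: "pos i < pos j" if "i < j" for i j :: 'm
  proof -
    have "j \<in> {l. l \<le> j}" "j \<notin> {l. l \<le> i}"
      using that by auto
    moreover have "{l. l \<le> i} \<subseteq> {l. l \<le> j}"
      using that by auto
    ultimately have "{l. l \<le> i} \<subset> {l. l \<le> j}"
      by blast
    then show ?thesis
      unfolding pos_def by (intro psubset_card_mono) auto
  qed
  have inj: "inj (pos :: 'm \<Rightarrow> nat)"
    by (rule linorder_injI) (use mono in \<open>metis less_irrefl\<close>)
  have "pos i \<in> {1..CARD('m)}" for i :: 'm
    unfolding pos_def by (auto simp: Suc_le_eq card_gt_0_iff intro!: card_mono)
  then have "range (pos :: 'm \<Rightarrow> nat) \<subseteq> {1..CARD('m)}"
    by blast
  moreover have "card (range (pos :: 'm \<Rightarrow> nat)) = card {1..CARD('m)}"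
    using inj by (simp add: card_image)
  ultimately have "range (pos :: 'm \<Rightarrow> nat) = {1..CARD('m)}"
    by (intro card_subset_eq) auto
  with inj show ?thesis
    by (simp add: bij_betw_def)
qed

definition first_comp :: "real ^ 'm::{finite,linorder} \<Rightarrow> real" where
  "first_comp x = x $ Min UNIV"

lemma pos_Min: "pos (Min UNIV :: 'm::{finite,linorder}) = 1"
proof -
  have "{j. j \<le> (Min UNIV :: 'm)} = {Min UNIV}"
    by (auto intro: antisym)
  then show ?thesis
    by (simp add: pos_def)
qed

text \<open>The polynomial $\sum_{i=1}^{m+1} c_i \lambda^{i-1}$.\<close>

definition coeff_poly :: "nat \<Rightarrow> (nat \<Rightarrow> real) \<Rightarrow> real poly" where
  "coeff_poly m c = (\<Sum>i=1..m+1. monom (c i) (i - 1))"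


subsection \<open>The estimation system\<close>

definition A_mat :: "(nat \<Rightarrow> real) \<Rightarrow> real ^ 'm::{finite,linorder} ^ 'm::{finite,linorder}" where
  "A_mat d = (\<chi> i j. if pos i = CARD('m) then - d (CARD('m) + 2 - pos j)
                     else if pos j = pos i + 1 then 1 else 0)"

definition B_vec :: "real ^ 'm::{finite,linorder}" where
  "B_vec = (\<chi> i. if pos i = CARD('m) then 1 else 0)"

text \<open>The row vector $C$ is represented as a vector, so that $C\mathbf{x}$ is the inner product.\<close>

definition C_vec :: "(nat \<Rightarrow> real) \<Rightarrow> (nat \<Rightarrow> real) \<Rightarrow> real ^ 'm::{finite,linorder}" where
  "C_vec d n = (\<chi> j. n (CARD('m) + 2 - pos j) - n 1 * d (CARD('m) + 2 - pos j))"

definition D1 :: "(nat \<Rightarrow> real) \<Rightarrow> real" where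
  "D1 n = n 1"

definition feasible ::
  "(nat \<Rightarrow> real) \<Rightarrow> (nat \<Rightarrow> real) \<Rightarrow> (nat \<Rightarrow> real) \<Rightarrow> nat \<Rightarrow> real ^ 'm::{finite,linorder} \<Rightarrow> real \<Rightarrow> bool"
where
  "feasible d n z k x v \<longleftrightarrow> \<bar>v\<bar> \<le> 1 \<and> \<bar>C_vec d n \<bullet> x + D1 n * v - z k\<bar> \<le> 1"

primrec uncertainty_set ::
  "(nat \<Rightarrow> real) \<Rightarrow> (nat \<Rightarrow> real) \<Rightarrow> (nat \<Rightarrow> real) \<Rightarrow> real ^ 'm::{finite,linorder} \<Rightarrow> nat \<Rightarrow> (real ^ 'm::{finite,linorder}) set"
where
  "uncertainty_set d n z x0 0 = {x0}"
| "uncertainty_set d n z x0 (Suc k) =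
     {A_mat d *v x + v *\<^sub>R B_vec | x v. x \<in> uncertainty_set d n z x0 k \<and> feasible d n z (Suc k) x v}"

definition successor ::
  "(nat \<Rightarrow> real) \<Rightarrow> (nat \<Rightarrow> real) \<Rightarrow> (nat \<Rightarrow> real) \<Rightarrow> real ^ 'm::{finite,linorder} \<Rightarrow> nat
    \<Rightarrow> real ^ 'm::{finite,linorder} \<Rightarrow> real ^ 'm::{finite,linorder} \<Rightarrow> bool"
where
  "successor d n z x0 k x' x \<longleftrightarrow>
     x' \<in> uncertainty_set d n z x0 k \<and> x \<in> uncertainty_set d n z x0 (k - 1) \<and>
     (\<exists>v. feasible d n z k x v \<and> x' = A_mat d *v x + v *\<^sub>R B_vec)"

lemma polytope_uncertainty_set: "polytope (uncertainty_set d n z x0 k)"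
proof (induction k)
  case 0
  show ?case
    by (simp add: polytope_sing)
next
  case (Suc k)
  let ?c = "(C_vec d n, D1 n)"
  let ?P = "uncertainty_set d n z x0 k \<times> {-1..1::real}
              \<inter> ({p. ?c \<bullet> p \<le> 1 + z (Suc k)} \<inter> {p. ?c \<bullet> p \<ge> z (Suc k) - 1})"
  let ?f = "\<lambda>p. A_mat d *v fst p + snd p *\<^sub>R B_vec"
  have "polytope {-1..1::real}"
    using polytope_interval[of "-1::real" 1] by (simp add: cbox_interval)
  then have P: "polytope ?P"
    using Suc by (intro polytope_Int_polyhedron polytope_Times polyhedron_Int
        polyhedron_halfspace_le polyhedron_halfspace_ge)
  have f: "linear ?f"
    by (intro linearI)
      (simp_all add: matrix_vector_right_distrib matrix_vector_mult_scaleR algebra_simps)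
  have S: "uncertainty_set d n z x0 (Suc k) = ?f ` ?P"
  proof (intro set_eqI iffI)
    fix w
    assume "w \<in> uncertainty_set d n z x0 (Suc k)"
    then obtain x v where "x \<in> uncertainty_set d n z x0 k" "feasible d n z (Suc k) x v"
      and w: "w = ?f (x, v)"
      by auto
    then have "(x, v) \<in> ?P"
      by (auto simp: feasible_def abs_le_iff)
    with w show "w \<in> ?f ` ?P"
      by blast
  next
    fix w
    assume "w \<in> ?f ` ?P"
    then obtain x v where "(x, v) \<in> ?P" and w: "w = ?f (x, v)"
      by auto
    then have "x \<in> uncertainty_set d n z x0 k" "feasible d n z (Suc k) x v"
      by (auto simp: feasible_def abs_le_iff)
    with w show "w \<in> uncertainty_set d n z x0 (Suc k)"
      by auto
  qed
  show ?case
    unfolding S by (rule polytope_linear_image[OF f P])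
qed


subsection \<open>The regulator matrices\<close>

definition A_star :: "(nat \<Rightarrow> real) \<Rightarrow> real ^ 'm::{finite,linorder} ^ 'm::{finite,linorder}" where
  "A_star d = (\<chi> i j. if pos j = 1 then - (1 / d (CARD('m) + 1)) * d (CARD('m) + 1 - pos i)
                      else if pos j = pos i + 1 then 1 else 0)"

definition B_star :: "(nat \<Rightarrow> real) \<Rightarrow> (nat \<Rightarrow> real) \<Rightarrow> real ^ 'm::{finite,linorder}" where
  "B_star d n = (\<chi> i. n (CARD('m) + 1 - pos i)
                      - n (CARD('m) + 1) / d (CARD('m) + 1) * d (CARD('m) + 1 - pos i))"


subsection \<open>Support function, outward normals and alignment\<close>

text \<open>For a nonempty polytope the supremum is attained, hence is the maximum.\<close>

definition support_fun :: "'a::real_inner set \<Rightarrow> 'a \<Rightarrow> real" where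
  "support_fun S xs = (SUP x\<in>S. xs \<bullet> x)"

definition outward_normals :: "'a::real_inner set \<Rightarrow> 'a \<Rightarrow> 'a set" where
  "outward_normals S x = {xs. xs \<noteq> 0 \<and> xs \<bullet> x = support_fun S xs}"

definition aligned :: "real \<Rightarrow> real \<times> real \<Rightarrow> real \<times> real \<Rightarrow> bool" where
  "aligned zk = (\<lambda>(y, v) (ys, vs).
     (vs > 0 \<longrightarrow> v = 1) \<and> (vs < 0 \<longrightarrow> v = -1) \<and> (\<bar>v\<bar> < 1 \<longrightarrow> vs = 0) \<and>
     (ys > 0 \<longrightarrow> y = 1 + zk) \<and> (ys < 0 \<longrightarrow> y = -1 + zk) \<and> (\<bar>y - zk\<bar> < 1 \<longrightarrow> ys = 0))"

text \<open>Here $m$ is an explicit argument, since the remaining ones do not determine the dimension.\<close>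

definition M_set ::
  "nat \<Rightarrow> (nat \<Rightarrow> real) \<Rightarrow> (nat \<Rightarrow> real) \<Rightarrow> real \<Rightarrow> real \<Rightarrow> real \<Rightarrow> (real \<times> real \<times> real \<times> real) set"
where
  "M_set m d n s t zk = {(v, y, vs, ys).
     \<bar>v\<bar> \<le> 1 \<and> \<bar>y - zk\<bar> \<le> 1 \<and>
     y - n 1 * v = s \<and>
     d (m + 1) * vs + n (m + 1) * ys = - t \<and>
     aligned zk (y, v) (ys, vs)}"

end

theory Submission
  imports Defs
begin

text \<open>
  The regulator step is adjoint to the estimator step: with $t = (\mathbf{x}^*)_1$, the relation
  $d_{m+1} v^* + n_{m+1} y^* = -t$ gives, for all $\mathbf{w}$ and $u$,
  \[\langle A^*\mathbf{x}^* + B^* y^*, A\mathbf{w} + Bu\rangle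
     = \langle \mathbf{x}^*, \mathbf{w}\rangle + v^* u + y^* (C\mathbf{w} + D_1 u).\]
  Over the feasible pairs $(\mathbf{w}, u)$ each of the three terms on the right is maximal at
  $(\mathbf{x}_{k-1}, v_k)$: the first by outward normality, the other two by alignment.
\<close>

text \<open>Index shifts such as \<open>p + 1\<close> have no direct meaning on \<open>'m\<close>;
  through \<open>of_pos\<close>, sums over \<open>'m\<close> become sums over an interval of
  naturals, where they do.\<close>

definition of_pos :: "nat \<Rightarrow> 'm::{finite,linorder}" where
  "of_pos = inv_into UNIV pos"

lemma pos_of_pos: "p \<in> {1..CARD('m)} \<Longrightarrow> pos (of_pos p :: 'm::{finite,linorder}) = p"
  unfolding of_pos_def using bij_betw_pos[where 'm='m]
  by (metis bij_betw_inv_into_right)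

lemma of_pos_1: "of_pos 1 = (Min UNIV :: 'm::{finite,linorder})"
  unfolding of_pos_def pos_Min[where 'm='m, symmetric]
  using bij_betw_pos[where 'm='m] by (simp add: bij_betw_def)

lemma sum_of_pos:
  "(\<Sum>i\<in>UNIV. f (i :: 'm::{finite,linorder})) = (\<Sum>p=1..CARD('m). f (of_pos p))"
  unfolding of_pos_def
  by (rule sum.reindex_bij_betw[symmetric, OF bij_betw_inv_into[OF bij_betw_pos]])

lemma A_mat_B_vec_nth:
  fixes w :: "real ^ 'm::{finite,linorder}"
  assumes "p \<in> {1..CARD('m)}"
  shows "(A_mat d *v w + u *\<^sub>R B_vec) $ of_pos p =
    (if p = CARD('m) then u - (\<Sum>r=1..CARD('m). d (CARD('m) + 2 - r) * w $ of_pos r)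
     else w $ of_pos (p + 1))"
proof -
  have "(A_mat d *v w) $ of_pos p = (\<Sum>r=1..CARD('m).
      if p = CARD('m) then - (d (CARD('m) + 2 - r) * w $ of_pos r)
      else if r = p + 1 then w $ of_pos r else 0)"
    unfolding matrix_vector_mult_def A_mat_def vec_lambda_beta sum_of_pos
    using assms by (intro sum.cong) (auto simp: pos_of_pos)
  then show ?thesis
    using assms by (auto simp: B_vec_def pos_of_pos sum_negf)
qed

text \<open>The second assumption eliminates \<open>first_comp a\<close>, the entry that the first
  column of \<open>A_star\<close> multiplies. The quotient in \<open>B_star\<close> then cancels,
  and no division remains.\<close>

lemma A_star_B_star_nth:
  fixes a :: "real ^ 'm::{finite,linorder}"
  assumes "d (CARD('m) + 1) \<noteq> 0"
    and "d (CARD('m) + 1) * vs + n (CARD('m) + 1) * ys = - first_comp a"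
    and "p \<in> {1..CARD('m)}"
  shows "(A_star d *v a + ys *\<^sub>R B_star d n) $ of_pos p =
    d (CARD('m) + 1 - p) * vs + n (CARD('m) + 1 - p) * ys
      + (if p = CARD('m) then 0 else a $ of_pos (p + 1))"
proof -
  let ?m = "CARD('m)"
  have a1: "a $ of_pos (Suc 0) = - (d (?m + 1) * vs + n (?m + 1) * ys)"
    using assms(2) of_pos_1[where 'm='m] by (simp add: first_comp_def)
  \<comment> \<open>Columns \<open>1\<close> and \<open>p + 1\<close> differ since \<open>p\<close>
    is at least \<open>1\<close>, so the two cases add up; column \<open>p + 1\<close> is out of
    range when \<open>p = ?m\<close>.\<close>
  have "(A_star d *v a) $ of_pos p = (\<Sum>r=1..?m.
      (if r = 1 then - (1 / d (?m + 1)) * d (?m + 1 - p) * a $ of_pos r else 0)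
      + (if r = p + 1 then a $ of_pos r else 0))"
    unfolding matrix_vector_mult_def A_star_def vec_lambda_beta sum_of_pos
    using assms(3) by (intro sum.cong) (auto simp: pos_of_pos)
  also have "\<dots> = - (1 / d (?m + 1)) * d (?m + 1 - p) * a $ of_pos 1
      + (if p = ?m then 0 else a $ of_pos (p + 1))"
    using assms(3) by (auto simp: sum.distrib)
  finally show ?thesis
    using assms(1,3) by (simp add: B_star_def pos_of_pos a1 field_simps)
qed

text \<open>Both vectors are shifts up to corrections: componentwise products below the last index
  become \<open>g (p + 1)\<close>, and only the last one involves \<open>u\<close>.\<close>

lemma inner_star_eq:
  fixes a w :: "real ^ 'm::{finite,linorder}"
  assumes "d 1 = 1" and d: "d (CARD('m) + 1) \<noteq> 0"
    and t: "d (CARD('m) + 1) * vs + n (CARD('m) + 1) * ys = - first_comp a"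
  shows "(A_star d *v a + ys *\<^sub>R B_star d n) \<bullet> (A_mat d *v w + u *\<^sub>R B_vec) =
    a \<bullet> w + vs * u + ys * (C_vec d n \<bullet> w + D1 n * u)"
proof -
  let ?m = "CARD('m)"
  define l where "l = ?m - 1"
  have m: "?m = Suc l"
    by (simp add: l_def)
  \<comment> \<open>\<open>- D\<close> is the last component of \<open>A_mat d *v w\<close>, and
    \<open>N\<close> is its analogue for the coefficients \<open>n\<close>.\<close>
  define D where "D = (\<Sum>r=1..?m. d (?m + 2 - r) * w $ of_pos r)"
  define N where "N = (\<Sum>r=1..?m. n (?m + 2 - r) * w $ of_pos r)"
  have C: "C_vec d n \<bullet> w = N - n 1 * D"
    by (simp add: C_vec_def inner_vec_def sum_of_pos D_def N_def pos_of_pos sum_distrib_left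
        sum_subtractf algebra_simps)
  define g where "g r = (d (?m + 2 - r) * vs + n (?m + 2 - r) * ys + a $ of_pos r) * w $ of_pos r"
    for r
  \<comment> \<open>By \<open>t\<close> the bracket in \<open>g 1\<close> vanishes, so a sum of
    \<open>g\<close> from index \<open>2\<close> may as well start at \<open>1\<close>.\<close>
  have g1: "g 1 = 0"
    using t of_pos_1[where 'm='m] by (simp add: g_def first_comp_def)
  have "(A_star d *v a + ys *\<^sub>R B_star d n) \<bullet> (A_mat d *v w + u *\<^sub>R B_vec) =
    (\<Sum>p=1..?m. (A_star d *v a + ys *\<^sub>R B_star d n) $ of_pos p
                * (A_mat d *v w + u *\<^sub>R B_vec) $ of_pos p)"
    by (simp add: inner_vec_def sum_of_pos)
  \<comment> \<open>At \<open>p = ?m\<close> the coefficient of \<open>vs\<close> is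
    \<open>d 1\<close>, which is \<open>1\<close>.\<close>
  also have "\<dots> = (\<Sum>p=1..?m. if p = ?m then (vs + n 1 * ys) * (u - D) else g (p + 1))"
  proof (rule sum.cong[OF refl])
    fix p
    assume p: "p \<in> {1..?m}"
    show "(A_star d *v a + ys *\<^sub>R B_star d n) $ of_pos p
        * (A_mat d *v w + u *\<^sub>R B_vec) $ of_pos p
      = (if p = ?m then (vs + n 1 * ys) * (u - D) else g (p + 1))"
      unfolding A_star_B_star_nth[where d=d and n=n, OF d t p] A_mat_B_vec_nth[OF p]
      using assms(1) by (simp add: D_def g_def)
  qed
  also have "\<dots> = (vs + n 1 * ys) * (u - D) + (\<Sum>p=1..l. g (Suc p))"
    by (simp add: m)
  also have "(\<Sum>p=1..l. g (Suc p)) = (\<Sum>r=1..?m. g r)"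
    using g1 sum.atLeast_Suc_atMost[of 1 "Suc l" g] sum.shift_bounds_cl_Suc_ivl[of g 1 l]
    by (simp add: m del: sum.cl_ivl_Suc)
  also have "\<dots> = vs * D + ys * N + a \<bullet> w"
    by (simp add: g_def D_def N_def inner_vec_def sum_of_pos sum.distrib sum_distrib_left
        algebra_simps)
  \<comment> \<open>The terms in \<open>vs * D\<close> cancel, and \<open>n 1 * (u - D) + N\<close>
    is the output for \<open>(w, u)\<close>.\<close>
  also have "(vs + n 1 * ys) * (u - D) + \<dots> = a \<bullet> w + vs * u + ys * (C_vec d n \<bullet> w + D1 n * u)"
    unfolding C D1_def by algebra
  finally show ?thesis .
qed

lemma inner_le_support_fun:
  assumes "compact S" "w \<in> S"
  shows "a \<bullet> w \<le> support_fun S a"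
  unfolding support_fun_def
  by (rule cSUP_upper[OF assms(2) bounded_imp_bdd_above])
    (intro compact_imp_bounded compact_continuous_image continuous_intros assms(1))

text \<open>Maximality at \<open>x\<close> confines \<open>S\<close> to a closed half-space with
  \<open>x\<close> on its bounding hyperplane, while interior points of \<open>S\<close> lie in the
  open half-space.\<close>

lemma outward_normals_and_frontierI:
  assumes "closed S" "x \<in> S" "a \<noteq> 0" and le: "\<And>w. w \<in> S \<Longrightarrow> a \<bullet> w \<le> a \<bullet> x"
  shows "a \<in> outward_normals S x" and "x \<in> frontier S"
proof -
  have "support_fun S a = a \<bullet> x"
    unfolding support_fun_def using assms(2) le by (intro cSup_eq_maximum) auto
  then show "a \<in> outward_normals S x"
    using assms(3) by (simp add: outward_normals_def)
  have "S \<subseteq> {w. a \<bullet> w \<le> a \<bullet> x}"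
    using le by auto
  then have "interior S \<subseteq> {w. a \<bullet> w < a \<bullet> x}"
    using interior_mono interior_halfspace_le[OF assms(3)] by metis
  then show "x \<in> frontier S"
    using assms(1,2) by (auto simp: frontier_def)
qed

text \<open>A nonzero multiplier pins its variable at the endpoint favoured by its sign; a zero
  multiplier gives equality.\<close>

lemma aligned_mult_le:
  assumes "aligned zk (y, v) (ys, vs)" "\<bar>u\<bar> \<le> 1" "\<bar>y' - zk\<bar> \<le> 1"
  shows "vs * u \<le> vs * v" and "ys * y' \<le> ys * y"
proof -
  have mult_le: "c * a \<le> c * b" if "c > 0 \<Longrightarrow> a \<le> b" "c < 0 \<Longrightarrow> b \<le> a" for a b c :: real
    using that by (cases c "0::real" rule: linorder_cases) simp_all
  have "vs > 0 \<Longrightarrow> v = 1" "vs < 0 \<Longrightarrow> v = -1" "ys > 0 \<Longrightarrow> y = 1 + zk" "ys < 0 \<Longrightarrow> y = -1 + zk"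
    using assms(1) unfolding aligned_def by blast+
  moreover have "u \<le> 1" "-1 \<le> u" "y' \<le> 1 + zk" "-1 + zk \<le> y'"
    using assms(2,3) by linarith+
  ultimately show "vs * u \<le> vs * v" "ys * y' \<le> ys * y"
    by (metis mult_le)+
qed

theorem theorem3p3:
  fixes d n z :: "nat \<Rightarrow> real"
    and x0 x xs :: "real ^ 'm::{finite,linorder}"
    and v y vs ys :: real
    and k :: nat
  assumes "d 1 = 1" and "d (CARD('m) + 1) \<noteq> 0"
    and "coprime (coeff_poly CARD('m) n) (coeff_poly CARD('m) d)"
    and "k \<ge> 1"
    and "interior (uncertainty_set d n z x0 (k - 1)) \<noteq> {}"
    and "x \<in> frontier (uncertainty_set d n z x0 (k - 1))"
    and "xs \<in> outward_normals (uncertainty_set d n z x0 (k - 1)) x"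
    and "(v, y, vs, ys) \<in> M_set CARD('m) d n (C_vec d n \<bullet> x) (first_comp xs) (z k)"
    and "A_star d *v xs + ys *\<^sub>R B_star d n \<noteq> 0"
  shows "A_mat d *v x + v *\<^sub>R B_vec \<in> frontier (uncertainty_set d n z x0 k)
    \<and> successor d n z x0 k (A_mat d *v x + v *\<^sub>R B_vec) x
    \<and> A_star d *v xs + ys *\<^sub>R B_star d n
        \<in> outward_normals (uncertainty_set d n z x0 k) (A_mat d *v x + v *\<^sub>R B_vec)"
proof -
  let ?S = "uncertainty_set d n z x0"
  obtain j where k: "k = Suc j"
    using assms(4) by (cases k) auto
  have M: "\<bar>v\<bar> \<le> 1" "\<bar>y - z k\<bar> \<le> 1" "y = C_vec d n \<bullet> x + D1 n * v"
    "d (CARD('m) + 1) * vs + n (CARD('m) + 1) * ys = - first_comp xs"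
    "aligned (z k) (y, v) (ys, vs)"
    using assms(8) by (auto simp: M_set_def D1_def)
  note adj = inner_star_eq[where d=d and n=n, OF assms(1,2) M(4)]
  have compact: "compact (?S i)" for i
    by (rule polytope_imp_compact[OF polytope_uncertainty_set])
  \<comment> \<open>Polytopes are closed, hence contain their boundary.\<close>
  have x: "x \<in> ?S j"
    using assms(6) frontier_subset_closed[OF compact_imp_closed[OF compact]]
    by (auto simp: k)
  have feas: "feasible d n z k x v"
    using M by (simp add: feasible_def)
  have mem: "A_mat d *v x + v *\<^sub>R B_vec \<in> ?S k"
    using x feas by (auto simp: k)
  have le: "(A_star d *v xs + ys *\<^sub>R B_star d n) \<bullet> w'
      \<le> (A_star d *v xs + ys *\<^sub>R B_star d n) \<bullet> (A_mat d *v x + v *\<^sub>R B_vec)"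
    if w': "w' \<in> ?S k" for w'
  proof -
    \<comment> \<open>Every point of \<open>?S k\<close> comes from a feasible pair, to which
      \<open>adj\<close> applies with the same multipliers \<open>vs\<close> and \<open>ys\<close>
      as at \<open>(x, v)\<close>.\<close>
    obtain w u where w: "w \<in> ?S j" "feasible d n z k w u" "w' = A_mat d *v w + u *\<^sub>R B_vec"
      using w' unfolding k uncertainty_set.simps by blast
    have "xs \<bullet> w \<le> xs \<bullet> x"
      using inner_le_support_fun[OF compact w(1)] assms(7) by (simp add: outward_normals_def k)
    moreover have "vs * u \<le> vs * v" "ys * (C_vec d n \<bullet> w + D1 n * u) \<le> ys * y"
      using aligned_mult_le[OF M(5)] w(2) by (auto simp: feasible_def)
    ultimately show ?thesis
      by (simp add: adj w(3) M(3))
  qed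
  show ?thesis
    using outward_normals_and_frontierI[OF compact_imp_closed[OF compact] mem assms(9) le]
      mem x feas by (auto simp: successor_def k)
qed

end
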